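(* Let $(A,[-,-],[-,-,-],\alpha,\beta)$ be a BiHom-Akivis algebra and let $\varphi,\psi:A\to A$ be self-morphisms of the BiHom-Akivis algebra $(A,[-,-],[-,-,-],\alpha,\beta)$ such that $\varphi\psi=\psi\varphi$. Define on $A$, for all $x,y,z\in A$, $$[x,y]_{\varphi,\psi}:=[\varphi(x),\psi(y)],\qquad [x,y,z]_{\varphi,\psi}:=\varphi\psi^{2}([x,y,z]).$$ Then $A_{\varphi,\psi}:=(A,[-,-]_{\varphi,\psi},[-,-,-]_{\varphi,\psi},\varphi\alpha,\psi\beta)$ is a BiHom-Akivis algebra. Moreover, if $(A,[-,-],[-,-,-],\alpha,\beta)$ is multiplicative, then $A_{\varphi,\psi}$ is also multiplicative.
   Context: All vector spaces are over a field $\mathbb{K}$ of characteristic $0$. A BiHom-Akivis algebra is a quintuple $(V,[-,-],[-,-,-],\alpha,\beta)$ where $V$ is a vector space, $\alpha,\beta:V\to V$ are commuting linear maps, $[-,-]:V\times V\to V$ is bilinear and BiHom-skew-symmetric, i.e. $[\beta(x),\alpha(y)]=-[\beta(y),\alpha(x)]$ for all $x,y$, and $[-,-,-]:V^{3}\to V$ is trilinear, such that for all $x,y,z\in V$ $$\sum_{\mathrm{cyc}}[\beta^2(x),[\beta(y),\alpha(z)]]=\sum_{\mathrm{cyc}}[x,y,z]-\sum_{\mathrm{cyc}}[y,x,z],$$ where $\sum_{\mathrm{cyc}}$ denotes the sum over the three cyclic permutations of $(x,y,z)$. It is multiplicative if $\alpha$ and $\beta$ are endomorphisms with respect to both $[-,-]$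 and $[-,-,-]$. A morphism $f:(A,[-,-],[-,-,-],\alpha,\beta)\to(\tilde A,\{-,-\},\{-,-,-\},\tilde\alpha,\tilde\beta)$ of BiHom-Akivis algebras is a linear map with $f\circ\alpha=\tilde\alpha\circ f$, $f\circ\beta=\tilde\beta\circ f$, $f([x,y])=\{f(x),f(y)\}$ and $f([x,y,z])=\{f(x),f(y),f(z)\}$. A self-morphism is a morphism from a BiHom-Akivis algebra to itself (in particular it commutes with $\alpha$ and $\beta$). *)

theory Defs
  imports Complex_Main
begin

definition bilinear_map :: "('k::field \<Rightarrow> 'a::ab_group_add \<Rightarrow> 'a) \<Rightarrow> ('a \<Rightarrow> 'a \<Rightarrow> 'a) \<Rightarrow> bool" where
  "bilinear_map s f \<longleftrightarrow>
     (\<forall>y. Vector_Spaces.linear s s (\<lambda>x. f x y)) \<and>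
     (\<forall>x. Vector_Spaces.linear s s (\<lambda>y. f x y))"

definition trilinear_map :: "('k::field \<Rightarrow> 'a::ab_group_add \<Rightarrow> 'a) \<Rightarrow> ('a \<Rightarrow> 'a \<Rightarrow> 'a \<Rightarrow> 'a) \<Rightarrow> bool" where
  "trilinear_map s f \<longleftrightarrow>
     (\<forall>y z. Vector_Spaces.linear s s (\<lambda>x. f x y z)) \<and>
     (\<forall>x z. Vector_Spaces.linear s s (\<lambda>y. f x y z)) \<and>
     (\<forall>x y. Vector_Spaces.linear s s (\<lambda>z. f x y z))"

definition cyc_sum :: "('a \<Rightarrow> 'a \<Rightarrow> 'a \<Rightarrow> 'b::ab_group_add) \<Rightarrow> 'a \<Rightarrow> 'a \<Rightarrow> 'a \<Rightarrow> 'b" where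
  "cyc_sum f x y z = f x y z + f y z x + f z x y"

text \<open>The underlying vector space is the whole type \<open>'a\<close>, with scalar multiplication \<open>scale\<close>
  over a field of characteristic 0; \<open>br\<close> and \<open>tr\<close> are the binary and the ternary bracket.\<close>

locale bihom_akivis_algebra = vector_space scale
  for scale :: "'k::field_char_0 \<Rightarrow> 'a::ab_group_add \<Rightarrow> 'a" +
  fixes br :: "'a \<Rightarrow> 'a \<Rightarrow> 'a"
    and tr :: "'a \<Rightarrow> 'a \<Rightarrow> 'a \<Rightarrow> 'a"
    and \<alpha> :: "'a \<Rightarrow> 'a"
    and \<beta> :: "'a \<Rightarrow> 'a"
  assumes linear_\<alpha>: "Vector_Spaces.linear scale scale \<alpha>"
    and linear_\<beta>: "Vector_Spaces.linear scale scale \<beta>"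
    and \<alpha>_\<beta>_commute: "\<alpha> \<circ> \<beta> = \<beta> \<circ> \<alpha>"
    and bilinear_br: "bilinear_map scale br"
    and trilinear_tr: "trilinear_map scale tr"
    and bihom_skew: "br (\<beta> x) (\<alpha> y) = - br (\<beta> y) (\<alpha> x)"
    and bihom_akivis:
      "cyc_sum (\<lambda>x y z. br (\<beta> (\<beta> x)) (br (\<beta> y) (\<alpha> z))) x y z =
       cyc_sum (\<lambda>x y z. tr x y z) x y z - cyc_sum (\<lambda>x y z. tr y x z) x y z"

locale multiplicative_bihom_akivis_algebra = bihom_akivis_algebra +
  assumes \<alpha>_br: "\<alpha> (br x y) = br (\<alpha> x) (\<alpha> y)"
    and \<alpha>_tr: "\<alpha> (tr x y z) = tr (\<alpha> x) (\<alpha> y) (\<alpha> z)"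
    and \<beta>_br: "\<beta> (br x y) = br (\<beta> x) (\<beta> y)"
    and \<beta>_tr: "\<beta> (tr x y z) = tr (\<beta> x) (\<beta> y) (\<beta> z)"

locale bihom_akivis_morphism =
  source: bihom_akivis_algebra scale br tr \<alpha> \<beta> +
  target: bihom_akivis_algebra scale' br' tr' \<alpha>' \<beta>'
  for scale :: "'k::field_char_0 \<Rightarrow> 'a::ab_group_add \<Rightarrow> 'a" and br tr \<alpha> \<beta>
    and scale' :: "'k \<Rightarrow> 'b::ab_group_add \<Rightarrow> 'b" and br' tr' \<alpha>' \<beta>' +
  fixes f :: "'a \<Rightarrow> 'b"
  assumes linear_f: "Vector_Spaces.linear scale scale' f"
    and f_\<alpha>: "f \<circ> \<alpha> = \<alpha>' \<circ> f"
    and f_\<beta>: "f \<circ> \<beta> = \<beta>' \<circ> f"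
    and f_br: "f (br x y) = br' (f x) (f y)"
    and f_tr: "f (tr x y z) = tr' (f x) (f y) (f z)"

abbreviation bihom_akivis_self_morphism where
  "bihom_akivis_self_morphism scale br tr \<alpha> \<beta> f \<equiv>
     bihom_akivis_morphism scale br tr \<alpha> \<beta> scale br tr \<alpha> \<beta> f"

definition twist_br :: "('a \<Rightarrow> 'a) \<Rightarrow> ('a \<Rightarrow> 'a) \<Rightarrow> ('a \<Rightarrow> 'a \<Rightarrow> 'a) \<Rightarrow> 'a \<Rightarrow> 'a \<Rightarrow> 'a" where
  "twist_br \<phi> \<psi> br x y = br (\<phi> x) (\<psi> y)"

definition twist_tr :: "('a \<Rightarrow> 'a) \<Rightarrow> ('a \<Rightarrow> 'a) \<Rightarrow> ('a \<Rightarrow> 'a \<Rightarrow> 'a \<Rightarrow> 'a) \<Rightarrow> 'a \<Rightarrow> 'a \<Rightarrow> 'a \<Rightarrow> 'a" where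
  "twist_tr \<phi> \<psi> tr x y z = \<phi> (\<psi> (\<psi> (tr x y z)))"

end

theory Submission imports Defs begin

text \<open>
  Write \<open>\<theta> = \<phi> \<psi>\<^sup>2\<close>. Self-morphisms commute with \<open>\<alpha>\<close> and \<open>\<beta>\<close> and pass through both brackets, and
  \<open>\<phi>\<close> and \<open>\<psi>\<close> commute with each other, so the maps \<open>\<phi>\<close> and \<open>\<psi>\<close> occurring in a twisted expression
  can all be collected at its innermost arguments, where their order does not matter. In the twisted
  BiHom-Jacobian
  \<open>[\<psi>\<beta>\<psi>\<beta> x, [\<psi>\<beta> y, \<phi>\<alpha> z]\<^bsub>\<phi>,\<psi>\<^esub>]\<^bsub>\<phi>,\<psi>\<^esub> = [\<theta>\<beta>\<^sup>2 x, [\<theta>\<beta> y, \<theta>\<alpha> z]]\<close>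
  every argument collects exactly one \<open>\<theta>\<close>. The outer \<open>\<psi>\<close> of the twisted bracket acts on the whole
  inner bracket, and this supplies the second \<open>\<psi>\<close> for \<open>y\<close> and \<open>z\<close>; for \<open>x\<close> it comes from the
  square of \<open>\<psi>\<beta>\<close>. As \<open>\<theta>\<close> also goes through the ternary bracket, the BiHom-Akivis identity of the
  twist at \<open>(x, y, z)\<close> is the original identity at \<open>(\<theta> x, \<theta> y, \<theta> z)\<close>. This explains the factor \<open>\<theta>\<close>
  in the twisted ternary bracket. In the same way skew-symmetry of the twist at
  \<open>(x, y)\<close> is the original one at \<open>(\<phi> \<psi> x, \<phi> \<psi> y)\<close>, and multiplicativity follows by pushing all
  maps inwards on both sides.
\<close>

locale commuting_self_morphisms =
  bihom_akivis_algebra scale br tr \<alpha> \<beta> +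
  \<phi>: bihom_akivis_morphism scale br tr \<alpha> \<beta> scale br tr \<alpha> \<beta> \<phi> +
  \<psi>: bihom_akivis_morphism scale br tr \<alpha> \<beta> scale br tr \<alpha> \<beta> \<psi>
  for scale :: "'k::field_char_0 \<Rightarrow> 'a::ab_group_add \<Rightarrow> 'a" and br tr \<alpha> \<beta> \<phi> \<psi> +
  assumes \<phi>_\<psi>_commute: "\<phi> \<circ> \<psi> = \<psi> \<circ> \<phi>"
begin

text \<open>
  Used as rewrite rules, these equations and the bracket equations of \<open>\<phi>\<close> and \<open>\<psi>\<close> move \<open>\<phi>\<close> and
  \<open>\<psi>\<close> to the innermost position and fix the order of all maps, so that two expressions that agree
  up to these commutations get the same normal form.
\<close>

lemma commutations:
  "\<alpha> (\<beta> x) = \<beta> (\<alpha> x)"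
  "\<phi> (\<alpha> x) = \<alpha> (\<phi> x)" "\<phi> (\<beta> x) = \<beta> (\<phi> x)"
  "\<psi> (\<alpha> x) = \<alpha> (\<psi> x)" "\<psi> (\<beta> x) = \<beta> (\<psi> x)"
  "\<phi> (\<psi> x) = \<psi> (\<phi> x)"
  using \<alpha>_\<beta>_commute \<phi>.f_\<alpha> \<phi>.f_\<beta> \<psi>.f_\<alpha> \<psi>.f_\<beta> \<phi>_\<psi>_commute
  by (simp_all add: fun_eq_iff)

lemmas push_inwards = commutations \<phi>.f_br \<psi>.f_br \<phi>.f_tr \<psi>.f_tr

lemma bilinear_twist_br: "bilinear_map scale (twist_br \<phi> \<psi> br)"
  unfolding bilinear_map_def twist_br_def
proof (intro conjI allI)
  show "Vector_Spaces.linear scale scale (\<lambda>x. br (\<phi> x) (\<psi> y))" for y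
    using Vector_Spaces.linear_compose[OF \<phi>.linear_f, of scale "\<lambda>x. br x (\<psi> y)"] bilinear_br
    by (simp add: bilinear_map_def o_def)
  show "Vector_Spaces.linear scale scale (\<lambda>y. br (\<phi> x) (\<psi> y))" for x
    using Vector_Spaces.linear_compose[OF \<psi>.linear_f, of scale "\<lambda>y. br (\<phi> x) y"] bilinear_br
    by (simp add: bilinear_map_def o_def)
qed

lemma trilinear_twist_tr: "trilinear_map scale (twist_tr \<phi> \<psi> tr)"
proof -
  have "Vector_Spaces.linear scale scale (\<lambda>u. \<phi> (\<psi> (\<psi> (g u))))"
    if "Vector_Spaces.linear scale scale g" for g
    using that[THEN Vector_Spaces.linear_compose, OF \<psi>.linear_f,
        THEN Vector_Spaces.linear_compose, OF \<psi>.linear_f,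
        THEN Vector_Spaces.linear_compose, OF \<phi>.linear_f]
    by (simp add: o_def)
  then show ?thesis
    using trilinear_tr unfolding trilinear_map_def twist_tr_def by blast
qed

lemma twist_bihom_akivis_algebra:
  "bihom_akivis_algebra scale (twist_br \<phi> \<psi> br) (twist_tr \<phi> \<psi> tr) (\<phi> \<circ> \<alpha>) (\<psi> \<circ> \<beta>)"
proof (intro bihom_akivis_algebra.intro bihom_akivis_algebra_axioms.intro)
  show "vector_space scale" ..
  show "Vector_Spaces.linear scale scale (\<phi> \<circ> \<alpha>)"
    by (rule Vector_Spaces.linear_compose[OF linear_\<alpha> \<phi>.linear_f])
  show "Vector_Spaces.linear scale scale (\<psi> \<circ> \<beta>)"
    by (rule Vector_Spaces.linear_compose[OF linear_\<beta> \<psi>.linear_f])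
  show "\<phi> \<circ> \<alpha> \<circ> (\<psi> \<circ> \<beta>) = \<psi> \<circ> \<beta> \<circ> (\<phi> \<circ> \<alpha>)"
    by (simp add: fun_eq_iff commutations)
  show "bilinear_map scale (twist_br \<phi> \<psi> br)"
    by (rule bilinear_twist_br)
  show "trilinear_map scale (twist_tr \<phi> \<psi> tr)"
    by (rule trilinear_twist_tr)
  show "twist_br \<phi> \<psi> br ((\<psi> \<circ> \<beta>) x) ((\<phi> \<circ> \<alpha>) y) =
      - twist_br \<phi> \<psi> br ((\<psi> \<circ> \<beta>) y) ((\<phi> \<circ> \<alpha>) x)" for x y
    using bihom_skew[of "\<psi> (\<phi> x)" "\<psi> (\<phi> y)"]
    by (simp add: twist_br_def commutations)
  show "cyc_sum (\<lambda>x y z. twist_br \<phi> \<psi> br ((\<psi> \<circ> \<beta>) ((\<psi> \<circ> \<beta>) x))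
          (twist_br \<phi> \<psi> br ((\<psi> \<circ> \<beta>) y) ((\<phi> \<circ> \<alpha>) z))) x y z =
      cyc_sum (\<lambda>x y z. twist_tr \<phi> \<psi> tr x y z) x y z -
      cyc_sum (\<lambda>x y z. twist_tr \<phi> \<psi> tr y x z) x y z" for x y z
    using bihom_akivis[of "\<psi> (\<psi> (\<phi> x))" "\<psi> (\<psi> (\<phi> y))" "\<psi> (\<psi> (\<phi> z))"]
    by (simp add: cyc_sum_def twist_br_def twist_tr_def push_inwards)
qed

lemma twist_multiplicative:
  assumes "multiplicative_bihom_akivis_algebra scale br tr \<alpha> \<beta>"
  shows "multiplicative_bihom_akivis_algebra scale
    (twist_br \<phi> \<psi> br) (twist_tr \<phi> \<psi> tr) (\<phi> \<circ> \<alpha>) (\<psi> \<circ> \<beta>)"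
proof -
  interpret mult: multiplicative_bihom_akivis_algebra scale br tr \<alpha> \<beta> by (rule assms)
  interpret twist: bihom_akivis_algebra scale
    "twist_br \<phi> \<psi> br" "twist_tr \<phi> \<psi> tr" "\<phi> \<circ> \<alpha>" "\<psi> \<circ> \<beta>"
    by (rule twist_bihom_akivis_algebra)
  show ?thesis
    by unfold_locales
      (simp_all add: twist_br_def twist_tr_def push_inwards
        mult.\<alpha>_br mult.\<alpha>_tr mult.\<beta>_br mult.\<beta>_tr)
qed

end

theorem theorem3p3:
  fixes scale :: "'k::field_char_0 \<Rightarrow> 'a::ab_group_add \<Rightarrow> 'a"
    and br :: "'a \<Rightarrow> 'a \<Rightarrow> 'a"
    and tr :: "'a \<Rightarrow> 'a \<Rightarrow> 'a \<Rightarrow> 'a"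
    and \<alpha> \<beta> \<phi> \<psi> :: "'a \<Rightarrow> 'a"
  assumes "bihom_akivis_algebra scale br tr \<alpha> \<beta>"
    and "bihom_akivis_self_morphism scale br tr \<alpha> \<beta> \<phi>"
    and "bihom_akivis_self_morphism scale br tr \<alpha> \<beta> \<psi>"
    and "\<phi> \<circ> \<psi> = \<psi> \<circ> \<phi>"
  shows "bihom_akivis_algebra scale (twist_br \<phi> \<psi> br) (twist_tr \<phi> \<psi> tr) (\<phi> \<circ> \<alpha>) (\<psi> \<circ> \<beta>) \<and>
    (multiplicative_bihom_akivis_algebra scale br tr \<alpha> \<beta> \<longrightarrow>
     multiplicative_bihom_akivis_algebra scale
       (twist_br \<phi> \<psi> br) (twist_tr \<phi> \<psi> tr) (\<phi> \<circ> \<alpha>) (\<psi> \<circ> \<beta>))"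
proof -
  interpret commuting_self_morphisms scale br tr \<alpha> \<beta> \<phi> \<psi>
    using assms
    by (intro commuting_self_morphisms.intro commuting_self_morphisms_axioms.intro)
  show ?thesis
    using twist_bihom_akivis_algebra twist_multiplicative by blast
qed

end
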